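(* Let $X$ be a discrete space and $R\subseteq X\times X$ a relation, regarded as the map $R:X\to P(X)$, $R(x)=\{y:R(x,y)\}$. Let $R^{\bullet}:X\to P_{\mathrm{cl}}(\beta X)$ be the map defined by $R^{\bullet}(x)=\mathrm{cl}_{\beta X}R(x)$ for all $x\in X$, and let $\widetilde{R^{\bullet}}:\beta X\to P_{\mathrm{cl}}(\beta X)$ be its unique continuous extension, where $P_{\mathrm{cl}}(\beta X)$ carries the Vietoris topology. Then the maps $R^*$ and $\widetilde{R^{\bullet}}$ coincide, where $R^*$ is regarded as the map of $\beta X$ into $P_{\mathrm{cl}}(\beta X)$ given by $R^*(u)=\{v\in\beta X:R^*(u,v)\}$.
   Context: $P(X)$ is the powerset of $X$. $\beta X$ denotes the set of ultrafilters over $X$, with the topology generated by the sets $\{u\in\beta X:S\in u\}$ for $S\subseteq X$; $X$ is identified with the set of principal ultrafilters, and $\mathrm{cl}_{\beta X}$ is the closure in $\beta X$. For $R\subseteq X\times X$ and $u,v\in\beta X$, $$R^*(u,v)\iff(\forall S\in v)\ \{x:(\exists y\in S)\,R(x,y)\}\in u.$$ For a topological space $Z$, $P_{\mathrm{cl}}(Z)$ is the set of non-empty closed subsets of $Z$, and the Vietoris topology on $P_{\mathrm{cl}}(Z)$ is the topology generated by the sets $\{B\in P_{\mathrm{cl}}(Z):B\subseteq O\}$ and $\{B\in P_{\mathrm{cl}}(Z):B\cap O\neq\emptyset\}$ for $O$ open in $Z$. The Vietoris topology on $P_{\mathrm{cl}}(\beta X)$ is compact Hausdorff, and every map of the discrete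 space $X$ into a compact Hausdorff space extends uniquely to a continuous map on $\beta X$.
   Formalization: The relation R is assumed to have R(x) non-empty for every x in X (equivalently, R^• really maps X into P_cl(βX)); otherwise cl R(x) is empty for some x and is not an element of P_cl(βX), so the extension is not defined. *)

theory Defs
  imports "HOL-Analysis.Analysis"
begin

definition ultrafilters :: "'a set \<Rightarrow> 'a set set set" where
  "ultrafilters X = {u. u \<subseteq> Pow X \<and> X \<in> u \<and> {} \<notin> u \<and>
     (\<forall>A\<in>u. \<forall>B\<in>u. A \<inter> B \<in> u) \<and>
     (\<forall>A\<in>u. \<forall>B. A \<subseteq> B \<and> B \<subseteq> X \<longrightarrow> B \<in> u) \<and>
     (\<forall>A. A \<subseteq> X \<longrightarrow> A \<in> u \<or> X - A \<in> u)}"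

definition principal_uf :: "'a set \<Rightarrow> 'a \<Rightarrow> 'a set set" where
  "principal_uf X x = {S. S \<subseteq> X \<and> x \<in> S}"

definition beta :: "'a set \<Rightarrow> 'a set set topology" where
  "beta X = topology_generated_by {{u \<in> ultrafilters X. S \<in> u} |S. S \<subseteq> X}"

definition P_cl :: "'a topology \<Rightarrow> 'a set set" where
  "P_cl Z = {B. closedin Z B \<and> B \<noteq> {}}"

definition vietoris :: "'a topology \<Rightarrow> 'a set topology" where
  "vietoris Z = topology_generated_by
     ({{B \<in> P_cl Z. B \<subseteq> U} |U. openin Z U} \<union>
      {{B \<in> P_cl Z. B \<inter> U \<noteq> {}} |U. openin Z U})"

text \<open>The points of \<^term>\<open>beta X\<close> are exactly the ultrafilters over \<^term>\<open>X\<close>, and those of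
  \<^term>\<open>vietoris Z\<close> exactly the non-empty closed subsets of \<^term>\<open>Z\<close>.\<close>

lemma topspace_beta: "topspace (beta X) = ultrafilters X"
proof
  show "topspace (beta X) \<subseteq> ultrafilters X"
    unfolding beta_def topology_generated_by_topspace by (rule Union_least) auto
  have "{u \<in> ultrafilters X. X \<in> u} \<subseteq> topspace (beta X)"
    unfolding beta_def topology_generated_by_topspace by (rule Union_upper, rule CollectI, rule exI[of _ X]) simp
  moreover have "X \<in> u" if "u \<in> ultrafilters X" for u
    using that by (simp add: ultrafilters_def)
  ultimately show "ultrafilters X \<subseteq> topspace (beta X)"
    by blast
qed

lemma topspace_vietoris: "topspace (vietoris Z) = P_cl Z"
proof
  show "topspace (vietoris Z) \<subseteq> P_cl Z"
    unfolding vietoris_def topology_generated_by_topspace by (rule Union_least) auto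
  have "{B \<in> P_cl Z. B \<subseteq> topspace Z} \<in> {{B \<in> P_cl Z. B \<subseteq> U} |U. openin Z U}"
    by (rule CollectI, rule exI[of _ "topspace Z"]) simp
  then have "{B \<in> P_cl Z. B \<subseteq> topspace Z} \<subseteq> topspace (vietoris Z)"
    unfolding vietoris_def topology_generated_by_topspace by (intro Union_upper UnI1)
  moreover have "{B \<in> P_cl Z. B \<subseteq> topspace Z} = P_cl Z"
    by (auto simp: P_cl_def dest: closedin_subset)
  ultimately show "P_cl Z \<subseteq> topspace (vietoris Z)"
    by simp
qed

text \<open>Since \<^term>\<open>X\<close> is discrete, a map \<^term>\<open>f\<close> from \<^term>\<open>X\<close> into the space \<^term>\<open>Z\<close> is subject
  to no continuity condition. Extensions are normalised to be \<^term>\<open>undefined\<close> off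
  \<^term>\<open>ultrafilters X\<close>, so that a map on \<^term>\<open>beta X\<close> is a unique function.\<close>

definition continuous_extension ::
    "'a set \<Rightarrow> 'b topology \<Rightarrow> ('a \<Rightarrow> 'b) \<Rightarrow> ('a set set \<Rightarrow> 'b) \<Rightarrow> bool" where
  "continuous_extension X Z f F \<longleftrightarrow>
     F \<in> extensional (ultrafilters X) \<and> continuous_map (beta X) Z F \<and>
     (\<forall>x\<in>X. F (principal_uf X x) = f x)"

definition the_extension ::
    "'a set \<Rightarrow> 'b topology \<Rightarrow> ('a \<Rightarrow> 'b) \<Rightarrow> 'a set set \<Rightarrow> 'b" where
  "the_extension X Z f = (THE F. continuous_extension X Z f F)"

definition R_star :: "'a set \<Rightarrow> ('a \<times> 'a) set \<Rightarrow> 'a set set \<Rightarrow> 'a set set \<Rightarrow> bool" where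
  "R_star X R u v \<longleftrightarrow> (\<forall>S\<in>v. {x \<in> X. \<exists>y\<in>S. (x, y) \<in> R} \<in> u)"

definition R_star_map :: "'a set \<Rightarrow> ('a \<times> 'a) set \<Rightarrow> 'a set set \<Rightarrow> 'a set set set" where
  "R_star_map X R = (\<lambda>u\<in>ultrafilters X. {v \<in> ultrafilters X. R_star X R u v})"

definition R_bullet :: "'a set \<Rightarrow> ('a \<times> 'a) set \<Rightarrow> 'a \<Rightarrow> 'a set set set" where
  "R_bullet X R x = (beta X) closure_of (principal_uf X ` (R `` {x}))"

end

theory Submission
  imports Defs
begin

text \<open>
  The extension is unique because the principal ultrafilters are dense in \<^term>\<open>beta X\<close> and the
  Vietoris topology over \<^term>\<open>beta X\<close> is Hausdorff. So it suffices to check that the map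
  \<^term>\<open>R_star_map X R\<close> is itself a continuous extension of \<^term>\<open>R_bullet X R\<close>; this also gives
  existence, and no general extension theorem is needed.

  The key observation is that \<^term>\<open>R_star X R u v\<close> holds iff \<^term>\<open>v\<close> contains every image
  \<open>R `` A\<close> with \<open>A \<in> u\<close> (lemma \<open>R_star_iff_Image\<close>), so that \<open>R\<^sup>*(u)\<close> consists of the
  ultrafilters extending the filter base of these images. Continuity is checked on the two kinds
  of subbasic sets of the Vietoris topology, each by extending a suitable filter base
  to an ultrafilter.

  \<^item> If \<open>R\<^sup>*(u) \<subseteq> U\<close> with \<open>U\<close> open, then some \<open>A \<in> u\<close> already has the property that \<open>U\<close> contains all
    ultrafilters \<open>v\<close> with \<open>R `` A \<in> v\<close>. For otherwise the sets \<open>R `` A\<close>, together with the sets that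
    belong to every ultrafilter outside \<open>U\<close>, generate a proper filter, and an ultrafilter
    extending it lies in \<open>R\<^sup>*(u) - U\<close>. Hence \<open>R\<^sup>*(w) \<subseteq> U\<close> whenever \<open>A \<in> w\<close>.

  \<^item> If \<open>v \<in> R\<^sup>*(u) \<inter> U\<close>, choose \<open>S \<in> v\<close> such that \<open>U\<close> contains all ultrafilters containing \<open>S\<close>. The
    preimage of \<open>S\<close> under \<open>R\<close> belongs to \<open>u\<close>, and whenever it belongs to an ultrafilter \<open>w\<close>,
    the sets \<open>R `` A \<inter> S\<close> with \<open>A \<in> w\<close> extend to a point of \<open>R\<^sup>*(w) \<inter> U\<close>.
\<close>

section \<open>Ultrafilters over a set\<close>

lemma ultrafilter_subset: "u \<in> ultrafilters X \<Longrightarrow> A \<in> u \<Longrightarrow> A \<subseteq> X"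
  by (auto simp: ultrafilters_def)

lemma ultrafilter_space: "u \<in> ultrafilters X \<Longrightarrow> X \<in> u"
  by (auto simp: ultrafilters_def)

lemma ultrafilter_empty: "u \<in> ultrafilters X \<Longrightarrow> {} \<notin> u"
  by (auto simp: ultrafilters_def)

lemma ultrafilter_Int: "u \<in> ultrafilters X \<Longrightarrow> A \<in> u \<Longrightarrow> B \<in> u \<Longrightarrow> A \<inter> B \<in> u"
  by (auto simp: ultrafilters_def)

lemma ultrafilter_mono: "u \<in> ultrafilters X \<Longrightarrow> A \<in> u \<Longrightarrow> A \<subseteq> B \<Longrightarrow> B \<subseteq> X \<Longrightarrow> B \<in> u"
  unfolding ultrafilters_def by blast

lemma ultrafilter_compl:
  assumes u: "u \<in> ultrafilters X" and A: "A \<subseteq> X"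
  shows "X - A \<in> u \<longleftrightarrow> A \<notin> u"
proof
  assume "X - A \<in> u"
  show "A \<notin> u"
  proof
    assume "A \<in> u"
    from ultrafilter_Int[OF u this \<open>X - A \<in> u\<close>] have "{} \<in> u" by simp
    then show False using ultrafilter_empty[OF u] by simp
  qed
qed (use u A in \<open>simp add: ultrafilters_def; blast\<close>)

lemma ultrafilters_containing_compl:
  assumes "S \<subseteq> X"
  shows "{w \<in> ultrafilters X. X - S \<in> w} = ultrafilters X - {w \<in> ultrafilters X. S \<in> w}"
  using ultrafilter_compl[OF _ assms] by auto

lemma principal_uf_in_ultrafilters: "x \<in> X \<Longrightarrow> principal_uf X x \<in> ultrafilters X"
  by (auto simp: principal_uf_def ultrafilters_def)

lemma filter_base_extends_to_ultrafilter:
  fixes X :: "'a set"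
  assumes sub: "\<B> \<subseteq> Pow X" and ne: "\<B> \<noteq> {}" and empty: "{} \<notin> \<B>"
    and dir: "\<And>A B. A \<in> \<B> \<Longrightarrow> B \<in> \<B> \<Longrightarrow> \<exists>C\<in>\<B>. C \<subseteq> A \<inter> B"
  obtains u where "u \<in> ultrafilters X" "\<B> \<subseteq> u"
proof -
  \<comment> \<open>the proper filters on \<open>X\<close> that extend \<open>\<B>\<close>, ordered by inclusion\<close>
  define \<FF> where "\<FF> = {F. F \<subseteq> Pow X \<and> {} \<notin> F \<and> \<B> \<subseteq> F \<and> (\<forall>A\<in>F. \<forall>B\<in>F. A \<inter> B \<in> F) \<and>
    (\<forall>A\<in>F. \<forall>B. A \<subseteq> B \<and> B \<subseteq> X \<longrightarrow> B \<in> F)}"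
  define F0 where "F0 = {C. C \<subseteq> X \<and> (\<exists>B\<in>\<B>. B \<subseteq> C)}"
  have "A \<inter> B \<in> F0" if AB: "A \<in> F0" "B \<in> F0" for A B
  proof -
    obtain A' B' where "A' \<in> \<B>" "A' \<subseteq> A" "B' \<in> \<B>" "B' \<subseteq> B"
      using AB unfolding F0_def by blast
    then have "\<exists>C\<in>\<B>. C \<subseteq> A \<inter> B" using dir[of A' B'] by blast
    then show ?thesis using AB unfolding F0_def by blast
  qed
  moreover have "{} \<notin> F0" unfolding F0_def using empty by auto
  moreover have "F0 \<subseteq> Pow X" "\<B> \<subseteq> F0" unfolding F0_def using sub by blast+
  moreover have "B \<in> F0" if "A \<in> F0" "A \<subseteq> B" "B \<subseteq> X" for A B
    using that unfolding F0_def by blast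
  ultimately have "F0 \<in> \<FF>" unfolding \<FF>_def by blast
  then have nonempty: "\<FF> \<noteq> {}" by blast
  have chain: "\<Union>\<C> \<in> \<FF>" if "\<C> \<noteq> {}" and ch: "subset.chain \<FF> \<C>" for \<C>
  proof -
    have "\<C> \<subseteq> \<FF>" using ch by (simp add: subset_chain_def)
    have C: "F \<subseteq> Pow X" "{} \<notin> F" "\<B> \<subseteq> F" "\<And>A B. A \<in> F \<Longrightarrow> B \<in> F \<Longrightarrow> A \<inter> B \<in> F"
      "\<And>A B. A \<in> F \<Longrightarrow> A \<subseteq> B \<Longrightarrow> B \<subseteq> X \<Longrightarrow> B \<in> F" if "F \<in> \<C>" for F
    proof -
      have "F \<in> \<FF>" using that \<open>\<C> \<subseteq> \<FF>\<close> by blast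
      then show "F \<subseteq> Pow X" "{} \<notin> F" "\<B> \<subseteq> F" "\<And>A B. A \<in> F \<Longrightarrow> B \<in> F \<Longrightarrow> A \<inter> B \<in> F"
        "\<And>A B. A \<in> F \<Longrightarrow> A \<subseteq> B \<Longrightarrow> B \<subseteq> X \<Longrightarrow> B \<in> F"
        unfolding \<FF>_def by simp_all
    qed
    have "A \<inter> B \<in> \<Union>\<C>" if AB: "A \<in> \<Union>\<C>" "B \<in> \<Union>\<C>" for A B
    proof -
      obtain F G where "F \<in> \<C>" "G \<in> \<C>" "A \<in> F" "B \<in> G" using AB by blast
      moreover have "F \<subseteq> G \<or> G \<subseteq> F"
        using ch \<open>F \<in> \<C>\<close> \<open>G \<in> \<C>\<close> unfolding subset_chain_def by blast
      ultimately obtain H where "H \<in> \<C>" "A \<in> H" "B \<in> H" by blast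
      with C(4)[of H] show ?thesis by blast
    qed
    moreover have "\<B> \<subseteq> \<Union>\<C>" using \<open>\<C> \<noteq> {}\<close> C(3) by blast
    moreover have "\<Union>\<C> \<subseteq> Pow X" "{} \<notin> \<Union>\<C>"
      using C(1,2) by blast+
    moreover have "B \<in> \<Union>\<C>" if "A \<in> \<Union>\<C>" "A \<subseteq> B" "B \<subseteq> X" for A B
      using C(5) that by (meson UnionE UnionI)
    ultimately show ?thesis unfolding \<FF>_def by blast
  qed
  from subset_Zorn_nonempty[OF nonempty chain]
  obtain M where M: "M \<in> \<FF>" and max: "\<And>F. F \<in> \<FF> \<Longrightarrow> M \<subseteq> F \<Longrightarrow> F = M"
    by blast
  have MX: "M \<subseteq> Pow X" "{} \<notin> M" "\<B> \<subseteq> M"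
    and MI: "\<And>A B. A \<in> M \<Longrightarrow> B \<in> M \<Longrightarrow> A \<inter> B \<in> M"
    and MU: "\<And>A B. A \<in> M \<Longrightarrow> A \<subseteq> B \<Longrightarrow> B \<subseteq> X \<Longrightarrow> B \<in> M"
    using M unfolding \<FF>_def by blast+
  obtain B0 where "B0 \<in> M" using ne MX(3) by blast
  then have XM: "X \<in> M" using MU[of B0 X] MX(1) by blast
  have "A \<in> M \<or> X - A \<in> M" if A: "A \<subseteq> X" for A
  proof (cases "\<exists>D\<in>M. D \<inter> A = {}")
    case True
    then obtain D where "D \<in> M" "D \<inter> A = {}" by blast
    then show ?thesis using MU[of D "X - A"] MX(1) by blast
  next
    case False
    \<comment> \<open>the filter generated by \<open>M\<close> and \<open>A\<close> is proper, hence equal to \<open>M\<close>\<close>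
    define G where "G = {C. C \<subseteq> X \<and> (\<exists>D\<in>M. D \<inter> A \<subseteq> C)}"
    have "C \<inter> C' \<in> G" if CC: "C \<in> G" "C' \<in> G" for C C'
    proof -
      obtain D D' where "D \<in> M" "D \<inter> A \<subseteq> C" "D' \<in> M" "D' \<inter> A \<subseteq> C'"
        using CC unfolding G_def by blast
      then have "D \<inter> D' \<in> M" "(D \<inter> D') \<inter> A \<subseteq> C \<inter> C'" using MI by blast+
      then show ?thesis using CC unfolding G_def by blast
    qed
    moreover have MG: "M \<subseteq> G" unfolding G_def using MX(1) by blast
    moreover have "\<B> \<subseteq> G" using MX(3) MG by blast
    moreover have "G \<subseteq> Pow X" "{} \<notin> G" unfolding G_def using False by auto
    moreover have "C' \<in> G" if "C \<in> G" "C \<subseteq> C'" "C' \<subseteq> X" for C C'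
      using that unfolding G_def by blast
    ultimately have "G \<in> \<FF>" unfolding \<FF>_def by blast
    then have "G = M" using max MG by blast
    moreover have "A \<in> G" unfolding G_def using XM A by blast
    ultimately show ?thesis by blast
  qed
  then have "M \<in> ultrafilters X"
    unfolding ultrafilters_def mem_Collect_eq
    by (intro conjI ballI allI impI MX(1,2) XM MI) (use MU in auto)
  with MX(3) show ?thesis using that by blast
qed

section \<open>The space of ultrafilters and its Vietoris topology\<close>

lemma openin_beta_basic: "S \<subseteq> X \<Longrightarrow> openin (beta X) {u \<in> ultrafilters X. S \<in> u}"
  unfolding beta_def by (rule topology_generated_by_Basis) blast

lemma openin_beta_iff:
  "openin (beta X) U \<longleftrightarrow> U \<subseteq> ultrafilters X \<and>
     (\<forall>u\<in>U. \<exists>S\<in>u. {v \<in> ultrafilters X. S \<in> v} \<subseteq> U)" (is "?L \<longleftrightarrow> ?R")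
proof
  assume U: ?L
  have "\<forall>u\<in>U \<inter> ultrafilters X. \<exists>S\<in>u. {v \<in> ultrafilters X. S \<in> v} \<subseteq> U"
    using openin_topology_generated_by[OF U[unfolded beta_def]]
  proof (induction rule: generate_topology_on.induct)
    case (Int a b)
    show ?case
    proof
      fix u assume u: "u \<in> a \<inter> b \<inter> ultrafilters X"
      then obtain S T where S: "S \<in> u" "{v \<in> ultrafilters X. S \<in> v} \<subseteq> a"
        and T: "T \<in> u" "{v \<in> ultrafilters X. T \<in> v} \<subseteq> b"
        using Int.IH by (meson IntD1 IntD2 IntI)
      have ST: "S \<subseteq> X" "T \<subseteq> X" using u S T ultrafilter_subset by blast+
      have "S \<inter> T \<in> u" using u S T ultrafilter_Int by blast
      moreover have "S \<in> v \<and> T \<in> v" if "v \<in> ultrafilters X" "S \<inter> T \<in> v" for v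
        using that ST ultrafilter_mono[of v X "S \<inter> T"] by blast
      ultimately show "\<exists>S\<in>u. {v \<in> ultrafilters X. S \<in> v} \<subseteq> a \<inter> b"
        using S(2) T(2) by blast
    qed
  next
    case (UN K)
    show ?case
    proof
      fix u assume "u \<in> \<Union>K \<inter> ultrafilters X"
      then obtain k where "k \<in> K" "u \<in> k \<inter> ultrafilters X" by blast
      then have "\<exists>S\<in>u. {v \<in> ultrafilters X. S \<in> v} \<subseteq> k" using UN.IH by blast
      then show "\<exists>S\<in>u. {v \<in> ultrafilters X. S \<in> v} \<subseteq> \<Union>K"
        using \<open>k \<in> K\<close> by (meson Sup_upper subset_trans)
    qed
  qed auto
  moreover have "U \<subseteq> ultrafilters X" using openin_subset[OF U] by (simp add: topspace_beta)
  ultimately show ?R by blast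
next
  assume R: ?R
  show ?L
  proof (subst openin_subopen, intro ballI)
    fix u assume "u \<in> U"
    with R obtain S where "S \<in> u" "{v \<in> ultrafilters X. S \<in> v} \<subseteq> U" "u \<in> ultrafilters X" by blast
    then show "\<exists>T. openin (beta X) T \<and> u \<in> T \<and> T \<subseteq> U"
      using openin_beta_basic[of S X] ultrafilter_subset[of u X S] by blast
  qed
qed

lemma closedin_beta_iff:
  "closedin (beta X) C \<longleftrightarrow> C \<subseteq> ultrafilters X \<and>
     (\<forall>u\<in>ultrafilters X - C. \<exists>S\<in>u. {v \<in> ultrafilters X. S \<in> v} \<inter> C = {})"
proof -
  have "{v \<in> ultrafilters X. S \<in> v} \<subseteq> ultrafilters X - C \<longleftrightarrow>
      {v \<in> ultrafilters X. S \<in> v} \<inter> C = {}" for S by blast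
  then show ?thesis unfolding closedin_def openin_beta_iff topspace_beta by simp
qed

lemma in_closure_of_principal_iff:
  assumes "A \<subseteq> X"
  shows "v \<in> beta X closure_of (principal_uf X ` A) \<longleftrightarrow> v \<in> ultrafilters X \<and> A \<in> v"
proof
  assume v: "v \<in> beta X closure_of (principal_uf X ` A)"
  then have vu: "v \<in> ultrafilters X" by (simp add: in_closure_of topspace_beta)
  moreover have "A \<in> v"
  proof (rule ccontr)
    assume "A \<notin> v"
    then have "v \<in> {u \<in> ultrafilters X. X - A \<in> u}" using vu ultrafilter_compl[OF vu assms] by blast
    moreover have "openin (beta X) {u \<in> ultrafilters X. X - A \<in> u}"
      by (rule openin_beta_basic) blast
    ultimately obtain y where "y \<in> principal_uf X ` A" "y \<in> {u \<in> ultrafilters X. X - A \<in> u}"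
      using v unfolding in_closure_of by meson
    then show False by (auto simp: principal_uf_def)
  qed
  ultimately show "v \<in> ultrafilters X \<and> A \<in> v" by blast
next
  assume v: "v \<in> ultrafilters X \<and> A \<in> v"
  show "v \<in> beta X closure_of (principal_uf X ` A)"
    unfolding in_closure_of topspace_beta
  proof (intro conjI allI impI)
    fix T assume "v \<in> T \<and> openin (beta X) T"
    then obtain S where S: "S \<in> v" "{v \<in> ultrafilters X. S \<in> v} \<subseteq> T"
      by (auto simp: openin_beta_iff)
    have "S \<inter> A \<noteq> {}" using v S(1) ultrafilter_Int ultrafilter_empty by metis
    then obtain x where x: "x \<in> S" "x \<in> A" by blast
    have "S \<in> principal_uf X x"
      using x v S(1) ultrafilter_subset[of v X S] by (auto simp: principal_uf_def)
    then have "principal_uf X x \<in> T"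
      using S(2) principal_uf_in_ultrafilters[of x X] x(2) assms by blast
    then show "\<exists>y. y \<in> principal_uf X ` A \<and> y \<in> T" using x(2) by blast
  qed (use v in blast)
qed

lemma principal_ufs_dense:
  "beta X closure_of (principal_uf X ` X) = ultrafilters X"
  using in_closure_of_principal_iff[of X X] ultrafilter_space by blast

lemma openin_vietoris_subset: "openin Z U \<Longrightarrow> openin (vietoris Z) {B \<in> P_cl Z. B \<subseteq> U}"
  unfolding vietoris_def by (rule topology_generated_by_Basis) blast

lemma openin_vietoris_meets: "openin Z U \<Longrightarrow> openin (vietoris Z) {B \<in> P_cl Z. B \<inter> U \<noteq> {}}"
  unfolding vietoris_def by (rule topology_generated_by_Basis) blast

lemma Hausdorff_vietoris_beta: "Hausdorff_space (vietoris (beta X))"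
proof -
  \<comment> \<open>a point of \<open>B\<close> outside the closed set \<open>C\<close> has a clopen neighbourhood disjoint from \<open>C\<close>;
    meeting it and lying in its complement are disjoint open conditions\<close>
  have sep: "\<exists>U V. openin (vietoris (beta X)) U \<and> openin (vietoris (beta X)) V \<and>
      B \<in> U \<and> C \<in> V \<and> disjnt U V"
    if B: "B \<in> P_cl (beta X)" and C: "C \<in> P_cl (beta X)" and "\<not> B \<subseteq> C" for B C
  proof -
    obtain v where v: "v \<in> B" "v \<notin> C" using \<open>\<not> B \<subseteq> C\<close> by blast
    have vu: "v \<in> ultrafilters X"
      using B v(1) closedin_subset[of "beta X" B] by (auto simp: P_cl_def topspace_beta)
    have CX: "C \<subseteq> ultrafilters X"
      using C by (auto simp: P_cl_def closedin_beta_iff)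
    obtain S where S: "S \<in> v" "{w \<in> ultrafilters X. S \<in> w} \<inter> C = {}"
      using C vu v(2) unfolding P_cl_def closedin_beta_iff by blast
    have SX: "S \<subseteq> X" using vu S(1) ultrafilter_subset by blast
    let ?U = "{D \<in> P_cl (beta X). D \<inter> {w \<in> ultrafilters X. S \<in> w} \<noteq> {}}"
    let ?V = "{D \<in> P_cl (beta X). D \<subseteq> {w \<in> ultrafilters X. X - S \<in> w}}"
    have "openin (vietoris (beta X)) ?U"
      by (intro openin_vietoris_meets openin_beta_basic SX)
    moreover have "openin (vietoris (beta X)) ?V"
      by (intro openin_vietoris_subset openin_beta_basic) blast
    moreover have "B \<in> ?U" using B v S(1) vu by blast
    moreover have "C \<in> ?V" using C CX S(2) ultrafilters_containing_compl[OF SX] by blast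
    moreover have "disjnt ?U ?V"
      unfolding ultrafilters_containing_compl[OF SX] disjnt_def by blast
    ultimately show ?thesis by blast
  qed
  show ?thesis
    unfolding Hausdorff_space_def topspace_vietoris
  proof (intro allI impI)
    fix B C assume BC: "B \<in> P_cl (beta X) \<and> C \<in> P_cl (beta X) \<and> B \<noteq> C"
    then consider "\<not> B \<subseteq> C" | "\<not> C \<subseteq> B" by blast
    then show "\<exists>U V. openin (vietoris (beta X)) U \<and> openin (vietoris (beta X)) V \<and>
      B \<in> U \<and> C \<in> V \<and> disjnt U V"
    proof cases
      case 1
      then show ?thesis using sep BC by blast
    next
      case 2
      then obtain U V where "openin (vietoris (beta X)) U" "openin (vietoris (beta X)) V"
        "C \<in> U" "B \<in> V" "disjnt U V" using sep BC by blast
      then show ?thesis using disjnt_sym by blast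
    qed
  qed
qed

lemma continuous_extension_unique:
  assumes Z: "Hausdorff_space Z"
    and F: "continuous_extension X Z f F" and G: "continuous_extension X Z f G"
  shows "F = G"
proof (rule extensionalityI[of _ "ultrafilters X"])
  fix u assume "u \<in> ultrafilters X"
  then have "u \<in> beta X closure_of (principal_uf X ` X)" by (simp add: principal_ufs_dense)
  then show "F u = G u"
  proof (rule forall_in_closure_of_eq[OF _ Z])
    show "F w = G w" if "w \<in> principal_uf X ` X" for w
      using that F G by (auto simp: continuous_extension_def)
  qed (use F G in \<open>auto simp: continuous_extension_def\<close>)
qed (use F G in \<open>auto simp: continuous_extension_def\<close>)

section \<open>The ultrafilter extension of a relation\<close>

lemma R_star_iff_Image:
  assumes R: "R \<subseteq> X \<times> X" and u: "u \<in> ultrafilters X" and v: "v \<in> ultrafilters X"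
  shows "R_star X R u v \<longleftrightarrow> (\<forall>A\<in>u. R `` A \<in> v)"
proof
  assume *: "R_star X R u v"
  show "\<forall>A\<in>u. R `` A \<in> v"
  proof (rule ballI, rule ccontr)
    fix A assume A: "A \<in> u" "R `` A \<notin> v"
    have "X - R `` A \<in> v" using ultrafilter_compl[OF v, of "R `` A"] R A by blast
    then have "{x \<in> X. \<exists>y\<in>X - R `` A. (x, y) \<in> R} \<in> u" using * by (auto simp: R_star_def)
    then have "A \<inter> {x \<in> X. \<exists>y\<in>X - R `` A. (x, y) \<in> R} \<in> u" using A ultrafilter_Int[OF u] by blast
    moreover have "A \<inter> {x \<in> X. \<exists>y\<in>X - R `` A. (x, y) \<in> R} = {}" by blast
    ultimately show False using ultrafilter_empty[OF u] by metis
  qed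
next
  assume *: "\<forall>A\<in>u. R `` A \<in> v"
  show "R_star X R u v"
    unfolding R_star_def
  proof (rule ballI, rule ccontr)
    fix S assume S: "S \<in> v" "{x \<in> X. \<exists>y\<in>S. (x, y) \<in> R} \<notin> u"
    let ?A = "X - {x \<in> X. \<exists>y\<in>S. (x, y) \<in> R}"
    have "?A \<in> u" using ultrafilter_compl[OF u, of "{x \<in> X. \<exists>y\<in>S. (x, y) \<in> R}"] S by blast
    then have "R `` ?A \<inter> S \<in> v" using * S ultrafilter_Int[OF v] by blast
    moreover have "R `` ?A \<inter> S = {}" by blast
    ultimately show False using ultrafilter_empty[OF v] by metis
  qed
qed

lemma in_R_star_map_iff:
  assumes "R \<subseteq> X \<times> X" "u \<in> ultrafilters X"
  shows "v \<in> R_star_map X R u \<longleftrightarrow> v \<in> ultrafilters X \<and> (\<forall>A\<in>u. R `` A \<in> v)"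
  using R_star_iff_Image[OF assms] assms(2) by (auto simp: R_star_map_def)

text \<open>
  The existence principle behind the non-emptiness of \<open>R\<^sup>*(u)\<close> and the continuity of \<open>R\<^sup>*\<close>: if
  every image \<open>R `` A\<close> with \<open>A \<in> u\<close> meets every member of a non-empty family of subsets of
  \<^term>\<open>X\<close> closed under binary intersection, then the whole family is contained in some
  \<open>v \<in> R\<^sup>*(u)\<close>.
\<close>

lemma R_star_map_extend:
  fixes X :: "'a set"
  assumes R: "R \<subseteq> X \<times> X" and u: "u \<in> ultrafilters X"
    and T: "\<T> \<noteq> {}" "\<T> \<subseteq> Pow X" "\<And>S T. S \<in> \<T> \<Longrightarrow> T \<in> \<T> \<Longrightarrow> S \<inter> T \<in> \<T>"
    and meet: "\<And>A T. A \<in> u \<Longrightarrow> T \<in> \<T> \<Longrightarrow> R `` A \<inter> T \<noteq> {}"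
  obtains v where "v \<in> R_star_map X R u" "\<T> \<subseteq> v"
proof -
  define \<B> where "\<B> = {R `` A \<inter> T |A T. A \<in> u \<and> T \<in> \<T>}"
  obtain v where v: "v \<in> ultrafilters X" "\<B> \<subseteq> v"
  proof (rule filter_base_extends_to_ultrafilter[of \<B> X])
    show "\<B> \<subseteq> Pow X" using T(2) unfolding \<B>_def by blast
    show "\<B> \<noteq> {}" using T(1) ultrafilter_space[OF u] unfolding \<B>_def by blast
    show "{} \<notin> \<B>" using meet unfolding \<B>_def by (smt (verit) mem_Collect_eq)
    fix B C assume "B \<in> \<B>" "C \<in> \<B>"
    then obtain A A' S S' where *: "A \<in> u" "A' \<in> u" "S \<in> \<T>" "S' \<in> \<T>"
      "B = R `` A \<inter> S" "C = R `` A' \<inter> S'" unfolding \<B>_def by blast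
    have "A \<inter> A' \<in> u" "S \<inter> S' \<in> \<T>" using * T(3) ultrafilter_Int[OF u] by auto
    then have "R `` (A \<inter> A') \<inter> (S \<inter> S') \<in> \<B>" unfolding \<B>_def by blast
    moreover have "R `` (A \<inter> A') \<inter> (S \<inter> S') \<subseteq> B \<inter> C" using * by blast
    ultimately show "\<exists>D\<in>\<B>. D \<subseteq> B \<inter> C" by blast
  qed blast
  obtain T0 where "T0 \<in> \<T>" using T(1) by blast
  have "R `` A \<in> v" if "A \<in> u" for A
    using ultrafilter_mono[OF v(1), of "R `` A \<inter> T0" "R `` A"] that \<open>T0 \<in> \<T>\<close> v(2) R
    unfolding \<B>_def by blast
  moreover have "T \<in> v" if "T \<in> \<T>" for T
    using ultrafilter_mono[OF v(1), of "R `` X \<inter> T" T] that v(2) T(2) ultrafilter_space[OF u]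
    unfolding \<B>_def by blast
  ultimately show ?thesis using that[of v] v(1) in_R_star_map_iff[OF R u] by blast
qed

lemma R_star_map_meets_basic:
  assumes R: "R \<subseteq> X \<times> X" and u: "u \<in> ultrafilters X" and S: "S \<subseteq> X"
    and pre: "{x \<in> X. \<exists>y\<in>S. (x, y) \<in> R} \<in> u"
  obtains v where "v \<in> R_star_map X R u" "S \<in> v"
proof (rule R_star_map_extend[OF R u, of "{S}"])
  fix A T assume A: "A \<in> u" and "T \<in> {S}"
  have "A \<inter> {x \<in> X. \<exists>y\<in>S. (x, y) \<in> R} \<noteq> {}"
    using ultrafilter_Int[OF u A pre] ultrafilter_empty[OF u] by metis
  then show "R `` A \<inter> T \<noteq> {}" using \<open>T \<in> {S}\<close> by blast
qed (use S in auto)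

lemma R_star_map_in_P_cl:
  assumes R: "R \<subseteq> X \<times> X" and serial: "X \<subseteq> Domain R" and u: "u \<in> ultrafilters X"
  shows "R_star_map X R u \<in> P_cl (beta X)"
proof -
  have "{x \<in> X. \<exists>y\<in>X. (x, y) \<in> R} = X" using serial R by blast
  then have "{x \<in> X. \<exists>y\<in>X. (x, y) \<in> R} \<in> u" using ultrafilter_space[OF u] by metis
  then obtain v where "v \<in> R_star_map X R u"
    using R_star_map_meets_basic[OF R u, of X] by blast
  moreover have "closedin (beta X) (R_star_map X R u)"
    unfolding closedin_beta_iff
  proof (intro conjI ballI)
    show "R_star_map X R u \<subseteq> ultrafilters X" using in_R_star_map_iff[OF R u] by blast
    fix v assume v: "v \<in> ultrafilters X - R_star_map X R u"
    then obtain A where A: "A \<in> u" "R `` A \<notin> v" using in_R_star_map_iff[OF R u] by blast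
    have RX: "R `` A \<subseteq> X" using R by blast
    then have "X - R `` A \<in> v" using v A(2) ultrafilter_compl[of v X, OF _ RX] by blast
    moreover have "{w \<in> ultrafilters X. X - R `` A \<in> w} \<inter> R_star_map X R u = {}"
      unfolding ultrafilters_containing_compl[OF RX] using in_R_star_map_iff[OF R u] A(1) by blast
    ultimately show "\<exists>S\<in>v. {w \<in> ultrafilters X. S \<in> w} \<inter> R_star_map X R u = {}" by blast
  qed
  ultimately show ?thesis by (auto simp: P_cl_def)
qed

lemma R_star_map_subset_open:
  assumes R: "R \<subseteq> X \<times> X" and u: "u \<in> ultrafilters X"
    and U: "openin (beta X) U" and sub: "R_star_map X R u \<subseteq> U"
  obtains A where "A \<in> u" "{v \<in> ultrafilters X. R `` A \<in> v} \<subseteq> U"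
proof (rule ccontr)
  assume "\<not> thesis"
  then have no: "\<exists>v\<in>ultrafilters X - U. R `` A \<in> v" if "A \<in> u" for A
    using that \<open>\<And>A. A \<in> u \<Longrightarrow> {v \<in> ultrafilters X. R `` A \<in> v} \<subseteq> U \<Longrightarrow> thesis\<close> by blast
  \<comment> \<open>the filter of sets belonging to all ultrafilters outside \<open>U\<close>\<close>
  define \<T> where "\<T> = {T. T \<subseteq> X \<and> (\<forall>w\<in>ultrafilters X - U. T \<in> w)}"
  obtain v where v: "v \<in> R_star_map X R u" "\<T> \<subseteq> v"
  proof (rule R_star_map_extend[OF R u, of \<T>])
    show "\<T> \<noteq> {}" unfolding \<T>_def using ultrafilter_space by blast
    show "\<T> \<subseteq> Pow X" unfolding \<T>_def by blast
    show "S \<inter> T \<in> \<T>" if "S \<in> \<T>" "T \<in> \<T>" for S T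
      using that ultrafilter_Int[of _ X S T] unfolding \<T>_def by auto
    fix A T assume "A \<in> u" "T \<in> \<T>"
    then obtain w where "w \<in> ultrafilters X" "R `` A \<in> w" "T \<in> w"
      using no[of A] unfolding \<T>_def by auto
    then show "R `` A \<inter> T \<noteq> {}" using ultrafilter_Int ultrafilter_empty by metis
  qed blast
  have vu: "v \<in> ultrafilters X" using v in_R_star_map_iff[OF R u] by blast
  obtain S where S: "S \<in> v" "{w \<in> ultrafilters X. S \<in> w} \<subseteq> U"
    using U v(1) sub unfolding openin_beta_iff by blast
  have "S \<subseteq> X" using ultrafilter_subset[OF vu S(1)] .
  then have "X - S \<in> \<T>" unfolding \<T>_def using S(2) ultrafilters_containing_compl[OF \<open>S \<subseteq> X\<close>] by blast
  then have "S \<notin> v" using v(2) ultrafilter_compl[OF vu \<open>S \<subseteq> X\<close>] by blast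
  then show False using S(1) by blast
qed

lemma continuous_map_R_star_map:
  assumes R: "R \<subseteq> X \<times> X" and serial: "X \<subseteq> Domain R"
  shows "continuous_map (beta X) (vietoris (beta X)) (R_star_map X R)"
proof -
  let ?F = "R_star_map X R"
  have Pcl: "?F u \<in> P_cl (beta X)" if "u \<in> ultrafilters X" for u
    using R_star_map_in_P_cl[OF R serial that] .
  have upper: "openin (beta X) {u \<in> ultrafilters X. ?F u \<subseteq> U}" if U: "openin (beta X) U" for U
    unfolding openin_beta_iff
  proof (intro conjI ballI)
    fix u assume "u \<in> {u \<in> ultrafilters X. ?F u \<subseteq> U}"
    then have u: "u \<in> ultrafilters X" "?F u \<subseteq> U" by auto
    obtain A where A: "A \<in> u" "{v \<in> ultrafilters X. R `` A \<in> v} \<subseteq> U"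
      using R_star_map_subset_open[OF R u(1) U u(2)] .
    have "?F w \<subseteq> U" if "w \<in> ultrafilters X" "A \<in> w" for w
      using in_R_star_map_iff[OF R that(1)] that(2) A(2) by blast
    then show "\<exists>S\<in>u. {v \<in> ultrafilters X. S \<in> v} \<subseteq> {u \<in> ultrafilters X. ?F u \<subseteq> U}"
      using A(1) by blast
  qed blast
  have lower: "openin (beta X) {u \<in> ultrafilters X. ?F u \<inter> U \<noteq> {}}"
    if U: "openin (beta X) U" for U
    unfolding openin_beta_iff
  proof (intro conjI ballI)
    fix u assume "u \<in> {u \<in> ultrafilters X. ?F u \<inter> U \<noteq> {}}"
    then obtain v where u: "u \<in> ultrafilters X" and v: "v \<in> ?F u" "v \<in> U" by blast
    obtain S where S: "S \<in> v" "{w \<in> ultrafilters X. S \<in> w} \<subseteq> U"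
      using U v(2) unfolding openin_beta_iff by blast
    let ?P = "{x \<in> X. \<exists>y\<in>S. (x, y) \<in> R}"
    have v': "v \<in> ultrafilters X" "R_star X R u v" using v(1) u by (auto simp: R_star_map_def)
    then have "?P \<in> u" using S(1) by (auto simp: R_star_def)
    moreover have "?F w \<inter> U \<noteq> {}" if w: "w \<in> ultrafilters X" "?P \<in> w" for w
    proof -
      obtain v2 where "v2 \<in> ?F w" "S \<in> v2"
        using R_star_map_meets_basic[OF R w(1) ultrafilter_subset[OF v'(1) S(1)] w(2)] .
      then show ?thesis using S(2) in_R_star_map_iff[OF R w(1)] by blast
    qed
    ultimately show "\<exists>S\<in>u. {v \<in> ultrafilters X. S \<in> v} \<subseteq> {u \<in> ultrafilters X. ?F u \<inter> U \<noteq> {}}"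
      by blast
  qed blast
  show ?thesis
    unfolding vietoris_def
  proof (rule continuous_on_generated_topo)
    show "?F ` topspace (beta X) \<subseteq> \<Union> ({{B \<in> P_cl (beta X). B \<subseteq> U} |U. openin (beta X) U} \<union>
      {{B \<in> P_cl (beta X). B \<inter> U \<noteq> {}} |U. openin (beta X) U})"
      using Pcl topspace_vietoris[of "beta X"]
      by (auto simp: topspace_beta vietoris_def)
    fix W assume "W \<in> {{B \<in> P_cl (beta X). B \<subseteq> U} |U. openin (beta X) U} \<union>
      {{B \<in> P_cl (beta X). B \<inter> U \<noteq> {}} |U. openin (beta X) U}"
    then obtain U where U: "openin (beta X) U"
      and "W = {B \<in> P_cl (beta X). B \<subseteq> U} \<or> W = {B \<in> P_cl (beta X). B \<inter> U \<noteq> {}}"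
      by (elim UnE CollectE exE conjE) (erule that, simp)+
    then have "?F -` W \<inter> topspace (beta X) = {u \<in> ultrafilters X. ?F u \<subseteq> U} \<or>
        ?F -` W \<inter> topspace (beta X) = {u \<in> ultrafilters X. ?F u \<inter> U \<noteq> {}}"
      using Pcl unfolding topspace_beta by auto
    then show "openin (beta X) (?F -` W \<inter> topspace (beta X))"
      using upper[OF U] lower[OF U] by (elim disjE) simp_all
  qed
qed

lemma R_star_map_principal:
  assumes R: "R \<subseteq> X \<times> X" and x: "x \<in> X"
  shows "R_star_map X R (principal_uf X x) = R_bullet X R x"
proof -
  have RX: "R `` {x} \<subseteq> X" using R by blast
  have "(\<forall>A\<in>principal_uf X x. R `` A \<in> v) \<longleftrightarrow> R `` {x} \<in> v" if v: "v \<in> ultrafilters X" for v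
  proof
    assume "\<forall>A\<in>principal_uf X x. R `` A \<in> v"
    then show "R `` {x} \<in> v" using x by (auto simp: principal_uf_def)
  next
    assume *: "R `` {x} \<in> v"
    show "\<forall>A\<in>principal_uf X x. R `` A \<in> v"
    proof
      fix A assume "A \<in> principal_uf X x"
      then have "R `` {x} \<subseteq> R `` A" by (auto simp: principal_uf_def)
      then show "R `` A \<in> v" using ultrafilter_mono[OF v *] R by blast
    qed
  qed
  then show ?thesis
    using in_R_star_map_iff[OF R principal_uf_in_ultrafilters[OF x]] in_closure_of_principal_iff[OF RX]
    unfolding R_bullet_def by blast
qed

theorem theorem9:
  fixes X :: "'a set" and R :: "('a \<times> 'a) set"
  assumes "R \<subseteq> X \<times> X"
    and "R_bullet X R \<in> X \<rightarrow> P_cl (beta X)"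
  shows "(\<exists>!F. continuous_extension X (vietoris (beta X)) (R_bullet X R) F) \<and>
    R_star_map X R \<in> ultrafilters X \<rightarrow> P_cl (beta X) \<and>
    R_star_map X R = the_extension X (vietoris (beta X)) (R_bullet X R)"
proof -
  let ?ext = "continuous_extension X (vietoris (beta X)) (R_bullet X R)"
  \<comment> \<open>the closure of the empty set is empty, so the values of \<open>R_bullet X R\<close> being non-empty
    forces every point of \<open>X\<close> to have a successor\<close>
  have serial: "X \<subseteq> Domain R"
  proof
    fix x assume "x \<in> X"
    then have "R_bullet X R x \<noteq> {}" using assms(2) by (auto simp: P_cl_def)
    then have "R `` {x} \<noteq> {}" unfolding R_bullet_def by fastforce
    then show "x \<in> Domain R" by blast
  qed
  have ext: "?ext (R_star_map X R)"
    unfolding continuous_extension_def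
    using continuous_map_R_star_map[OF assms(1) serial] R_star_map_principal[OF assms(1)]
    by (simp add: R_star_map_def)
  moreover have uniq: "F = R_star_map X R" if "?ext F" for F
    using continuous_extension_unique[OF Hausdorff_vietoris_beta that ext] .
  ultimately have "\<exists>!F. ?ext F" by blast
  moreover have "R_star_map X R = the_extension X (vietoris (beta X)) (R_bullet X R)"
    unfolding the_extension_def using the_equality[of ?ext, OF ext uniq] by simp
  moreover have "R_star_map X R \<in> ultrafilters X \<rightarrow> P_cl (beta X)"
    using R_star_map_in_P_cl[OF assms(1) serial] by blast
  ultimately show ?thesis by blast
qed

end
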